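(* Let $\Delta\subset\mathbb C$ be the open unit disc, $\Delta^*=\Delta\setminus\{0\}$, and let $Z=(Z_1,\dots,Z_n):\Delta^*\to(\mathbb C^* )^n$ be holomorphic. Assume that there exist $\nu=(\nu_1,\dots,\nu_n)\in\mathbb Z^n$, an integer $q\neq0$, and a holomorphic function $u$ on $\Delta$ with $u(0)\neq0$ such that $Z_1^{\nu_1}\cdots Z_n^{\nu_n}=s^q u(s)$ on $\Delta^*$. Assume also that the local logarithmic limit set of $Z$ at $0$ is finite and contains no vector orthogonal to $\nu$. Then every coordinate function $Z_i$ is meromorphic at $0$.
   Context: Put $L(s)=(\log|Z_1(s)|,\dots,\log|Z_n(s)|)\in\mathbb R^n$. The local logarithmic limit set of $Z$ at $0$ is the set of all $\xi\in S^{n-1}$ for which there is a sequence $s_m\in\Delta^*$ with $s_m\to0$, $\|L(s_m)\|\to+\infty$ and $L(s_m)/\|L(s_m)\|\to\xi$. Orthogonality is with respect to the standard inner product of $\mathbb R^n$. "Meromorphic at $0$" means that the isolated singularity at $0$ is removable or a pole. *)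

theory Defs
  imports "HOL-Complex_Analysis.Complex_Analysis"
begin

abbreviation unit_disc :: "complex set" where
  "unit_disc \<equiv> ball 0 1"

abbreviation punctured_unit_disc :: "complex set" where
  "punctured_unit_disc \<equiv> unit_disc - {0}"

definition log_map :: "(complex \<Rightarrow> complex ^ 'n) \<Rightarrow> complex \<Rightarrow> real ^ 'n" where
  "log_map Z s = (\<chi> i. ln (norm (Z s $ i)))"

definition local_log_limit_set :: "(complex \<Rightarrow> complex ^ 'n) \<Rightarrow> (real ^ 'n) set" where
  "local_log_limit_set Z =
    {\<xi> \<in> sphere 0 1. \<exists>s :: nat \<Rightarrow> complex.
       (\<forall>m. s m \<in> punctured_unit_disc) \<and>
       s \<longlonglongrightarrow> 0 \<and>
       filterlim (\<lambda>m. norm (log_map Z (s m))) at_top sequentially \<and>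
       (\<lambda>m. log_map Z (s m) /\<^sub>R norm (log_map Z (s m))) \<longlonglongrightarrow> \<xi>}"

text \<open>
  The predicate \<open>not_essential f a\<close> says that \<open>f\<close> has a finite limit at \<open>a\<close> (for an isolated
  singularity, by Riemann's theorem, this means that it is removable) or a pole at \<open>a\<close>.
\<close>

definition meromorphic_at :: "(complex \<Rightarrow> complex) \<Rightarrow> complex \<Rightarrow> bool" where
  "meromorphic_at f a \<longleftrightarrow> isolated_singularity_at f a \<and> not_essential f a"

end

theory Submission
  imports Defs
begin

text \<open>
  Pairing \<open>L(s)\<close> with \<open>\<nu>\<close> gives \<open>q ln |s| + ln |u(s)|\<close>, which is unbounded of order \<open>ln |s|\<close>.
  By compactness of the sphere, if no limit direction of \<open>L\<close> is orthogonal to \<open>\<nu>\<close>, then \<open>\<parallel>L(s)\<parallel>\<close> is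
  bounded by a multiple of \<open>\<bar>\<langle>L(s), \<nu>\<rangle>\<bar>\<close>, hence by a multiple of \<open>\<bar>ln |s|\<bar>\<close>. So every
  \<open>|Z\<^sub>i|\<close> grows at most like a power of \<open>1/|s|\<close>, and Riemann's removable singularity theorem applies
  to \<open>s\<^sup>N Z\<^sub>i\<close>.
\<close>

text \<open>\<open>ln\<close> of the norm turns products into sums and integer powers into integer
  multiples, the factors being nonzero. This converts the monomial identity into a linear condition
  on \<open>log_map Z s\<close>.\<close>

lemma inner_log_map:
  fixes Z :: "complex \<Rightarrow> complex ^ 'n" and \<nu> :: "int ^ 'n"
  assumes "\<And>i. Z s $ i \<noteq> 0"
  shows "inner (log_map Z s) (\<chi> i. real_of_int (\<nu> $ i))
       = ln (norm (\<Prod>i\<in>UNIV. (Z s $ i) powi (\<nu> $ i)))"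
proof -
  have "ln (norm (\<Prod>i\<in>UNIV. (Z s $ i) powi (\<nu> $ i)))
      = (\<Sum>i\<in>UNIV. ln (norm (Z s $ i) powi (\<nu> $ i)))"
    using assms by (simp add: prod_norm[symmetric] norm_power_int ln_prod)
  also have "\<dots> = (\<Sum>i\<in>UNIV. real_of_int (\<nu> $ i) * ln (norm (Z s $ i)))"
    using assms by (simp add: ln_powr flip: powr_real_of_int')
  finally show ?thesis
    by (simp add: inner_vec_def log_map_def mult.commute)
qed

text \<open>If every \<open>c\<close> failed, points tending to 0 would have normalised logarithms
  whose pairing with \<open>v\<close> tends to 0. A convergent subsequence on the compact sphere
  would then give a limit direction orthogonal to \<open>v\<close>. The hypothesis
  \<open>lim\<close> supplies the divergence of norms that the definition of a limit direction
  demands.\<close>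

lemma log_map_norm_bound:
  fixes Z :: "complex \<Rightarrow> complex ^ 'n" and v :: "real ^ 'n"
  assumes lim: "filterlim (\<lambda>s. norm (log_map Z s)) at_top (at 0)"
    and v: "\<And>\<xi>. \<xi> \<in> local_log_limit_set Z \<Longrightarrow> \<not> orthogonal \<xi> v"
  obtains c where "c > 0" "\<forall>\<^sub>F s in at 0. c * norm (log_map Z s) \<le> \<bar>inner (log_map Z s) v\<bar>"
proof (rule ccontr)
  note witness = that
  assume no_bound: "\<not> thesis"
  have freq: "\<exists>\<^sub>F s in at 0. \<bar>inner (log_map Z s) v\<bar> < c * norm (log_map Z s)" if "c > 0" for c
    using no_bound witness[OF that] by (auto simp: frequently_def not_less)
  \<comment> \<open>One point per \<open>m\<close>, with \<open>c = 1 / Suc m\<close> in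
    \<open>freq\<close>, combines nearness to 0, large norm and near-orthogonality to
    \<open>v\<close>.\<close>
  have "\<exists>s. s \<in> punctured_unit_disc \<and> norm s < 1 / real (Suc m) \<and> real m \<le> norm (log_map Z s) \<and>
      \<bar>inner (log_map Z s) v\<bar> < 1 / real (Suc m) * norm (log_map Z s)" for m
  proof -
    have "\<forall>\<^sub>F s in at 0. s \<in> punctured_unit_disc \<and> norm s < 1 / real (Suc m)"
      using eventually_at_in_open[OF open_ball, of "0::complex" 0 1]
        eventually_at_in_open[OF open_ball, of "0::complex" 0 "1 / real (Suc m)"]
      by (simp add: eventually_conj_iff)
    moreover have "\<forall>\<^sub>F s in at 0. real m \<le> norm (log_map Z s)"
      using lim by (simp add: filterlim_at_top)
    ultimately have "\<forall>\<^sub>F s in at 0. s \<in> punctured_unit_disc \<and> norm s < 1 / real (Suc m) \<and>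
        real m \<le> norm (log_map Z s)"
      by eventually_elim auto
    from frequently_ex[OF frequently_eventually_conj[OF freq[of "1 / real (Suc m)"] this]]
    show ?thesis by auto
  qed
  then obtain s where s: "\<And>m. s m \<in> punctured_unit_disc" "\<And>m. norm (s m) < 1 / real (Suc m)"
      "\<And>m. real m \<le> norm (log_map Z (s m))"
      "\<And>m. \<bar>inner (log_map Z (s m)) v\<bar> < 1 / real (Suc m) * norm (log_map Z (s m))"
    by metis
  \<comment> \<open>The lower bound \<open>real m\<close> says nothing at \<open>m = 0\<close>;
    positivity comes from the strict inequality in \<open>s(4)\<close>, which fails for a zero
    vector.\<close>
  have pos: "norm (log_map Z (s m)) > 0" for m
    using s(4)[of m] by (cases "log_map Z (s m) = 0") auto
  define \<theta> where "\<theta> m = log_map Z (s m) /\<^sub>R norm (log_map Z (s m))" for m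
  have "\<theta> m \<in> sphere 0 1" for m
    using pos[of m] by (simp add: \<theta>_def)
  then obtain \<xi> r where \<xi>: "\<xi> \<in> sphere 0 1" and r: "strict_mono r" "(\<theta> \<circ> r) \<longlonglongrightarrow> \<xi>"
    using compact_sphere[of "0 :: real ^ 'n" 1] unfolding compact_def by metis
  have inv: "(\<lambda>m. 1 / real (Suc m)) \<longlonglongrightarrow> 0"
    by (rule LIMSEQ_Suc[OF lim_1_over_n])
  have s0: "s \<longlonglongrightarrow> 0"
    by (rule Lim_null_comparison[OF _ inv]) (simp add: s(2) less_imp_le del: of_nat_Suc)
  have top: "filterlim (\<lambda>m. norm (log_map Z (s m))) at_top sequentially"
    by (rule filterlim_at_top_mono[OF filterlim_real_sequentially]) (use s(3) in auto)
  \<comment> \<open>Convergence to 0 and divergence of the norms pass to the subsequence, so \<xi>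
    is a limit direction of \<open>Z\<close>.\<close>
  have "(s \<circ> r) \<longlonglongrightarrow> 0"
    by (rule LIMSEQ_subseq_LIMSEQ[OF s0 r(1)])
  moreover have "filterlim (\<lambda>m. norm (log_map Z ((s \<circ> r) m))) at_top sequentially"
    using filterlim_compose[OF top filterlim_subseq[OF r(1)]] by (simp add: comp_def)
  ultimately have "\<xi> \<in> local_log_limit_set Z"
    using \<xi> r(2) s(1)
    by (auto simp: local_log_limit_set_def \<theta>_def comp_def intro!: exI[of _ "\<lambda>m. s (r m)"])
  have lim0: "(\<lambda>m. inner (\<theta> m) v) \<longlonglongrightarrow> 0"
  proof (rule Lim_null_comparison[OF _ inv], intro always_eventually allI)
    fix m
    show "norm (inner (\<theta> m) v) \<le> 1 / real (Suc m)"
      using s(4)[of m] pos[of m] by (simp add: \<theta>_def abs_mult field_simps)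
  qed
  have "(\<lambda>m. inner ((\<theta> \<circ> r) m) v) \<longlonglongrightarrow> 0"
    using LIMSEQ_subseq_LIMSEQ[OF lim0 r(1)] by (simp add: comp_def)
  then have "inner \<xi> v = 0"
    using LIMSEQ_unique[OF tendsto_inner[OF r(2) tendsto_const]] by blast
  with \<open>\<xi> \<in> local_log_limit_set Z\<close> show False
    using v by (simp add: orthogonal_def)
qed

text \<open>By Riemann's theorem the bounded product extends to a holomorphic \<open>g\<close> on
  \<open>S\<close>. Near \<open>a\<close>, \<open>f\<close> is then the quotient of \<open>g\<close>
  by a power of \<open>z - a\<close>, and a quotient of analytic functions has no essential
  singularity.\<close>

lemma not_essential_of_bounded_power_mult:
  assumes f: "f holomorphic_on S - {a}" and S: "open S" "a \<in> S"
    and bound: "\<forall>\<^sub>F z in at a. norm ((z - a) ^ N * f z) \<le> B"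
  shows "not_essential f a"
proof -
  have "(\<lambda>z. (z - a) ^ N * f z) holomorphic_on S - {a}"
    by (intro holomorphic_intros f)
  from holomorphic_on_extend_bounded[OF this, THEN iffD2, OF _ exI, OF _ bound]
  obtain g where g: "g holomorphic_on S" and gf: "\<And>z. z \<in> S - {a} \<Longrightarrow> g z = (z - a) ^ N * f z"
    using S by (auto simp: interior_open)
  have an: "g analytic_on {a}" "(\<lambda>z. (z - a) ^ N) analytic_on {a}"
    using g S analytic_at[of g a] by (auto intro!: analytic_intros)
  have "not_essential (\<lambda>z. g z / (z - a) ^ N) a"
    using an by (intro not_essential_divide not_essential_analytic isolated_singularity_at_analytic)
  moreover have "\<forall>\<^sub>F z in at a. g z / (z - a) ^ N = f z"
    using eventually_at_in_open[OF S] by eventually_elim (simp add: gf)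
  ultimately show ?thesis
    by (rule not_essential_transform)
qed

theorem lemma2p2:
  fixes Z :: "complex \<Rightarrow> complex ^ 'n"
    and \<nu> :: "int ^ 'n"
    and q :: int
    and u :: "complex \<Rightarrow> complex"
  assumes Z_holomorphic: "\<And>i. (\<lambda>s. Z s $ i) holomorphic_on punctured_unit_disc"
    and Z_nonzero: "\<And>i s. s \<in> punctured_unit_disc \<Longrightarrow> Z s $ i \<noteq> 0"
    and q_nonzero: "q \<noteq> 0"
    and u_holomorphic: "u holomorphic_on unit_disc"
    and u_nonzero: "u 0 \<noteq> 0"
    and monomial: "\<And>s. s \<in> punctured_unit_disc \<Longrightarrow>
          (\<Prod>i\<in>UNIV. (Z s $ i) powi (\<nu> $ i)) = s powi q * u s"
    and finite_limit_set: "finite (local_log_limit_set Z)"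
    and not_orthogonal: "\<And>\<xi>. \<xi> \<in> local_log_limit_set Z \<Longrightarrow>
          \<not> orthogonal \<xi> (\<chi> i. real_of_int (\<nu> $ i))"
  shows "\<forall>i. meromorphic_at (\<lambda>s. Z s $ i) 0"
proof -
  define v :: "real ^ 'n" where "v = (\<chi> i. real_of_int (\<nu> $ i))"
  \<comment> \<open>The summand 1 puts \<open>K\<close> strictly above the limit of
    \<open>\<bar>ln (norm (u s))\<bar>\<close> at 0, so \<open>K\<close> bounds this quantity near
    0.\<close>
  define K where "K = \<bar>ln (norm (u 0))\<bar> + 1"
  have disc: "\<forall>\<^sub>F s in at 0. s \<in> punctured_unit_disc"
    by (rule eventually_at_in_open) auto
  have log: "filterlim (\<lambda>s::complex. - ln (norm s)) at_top (at 0)"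
  proof -
    have "filterlim (\<lambda>s::complex. norm s) (at_right 0) (at 0)"
      unfolding filterlim_at by (auto simp: eventually_at_filter intro!: tendsto_eq_intros)
    then show ?thesis
      using filterlim_compose[OF ln_at_0] by (simp add: filterlim_uminus_at_top)
  qed
  have u_lim: "u \<midarrow>0\<rightarrow> u 0"
    using u_holomorphic continuous_on_eq_continuous_at[of unit_disc u]
    by (auto dest: holomorphic_on_imp_continuous_on simp: isCont_def)
  then have "((\<lambda>s. \<bar>ln (norm (u s))\<bar>) \<longlongrightarrow> \<bar>ln (norm (u 0))\<bar>) (at 0)"
    using u_nonzero by (intro tendsto_intros) auto
  then have u_bound: "\<forall>\<^sub>F s in at 0. \<bar>ln (norm (u s))\<bar> < K"
    by (rule order_tendstoD) (simp add: K_def)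
  have u_ne: "\<forall>\<^sub>F s in at 0. u s \<noteq> 0"
    using u_lim u_nonzero by (rule tendsto_imp_eventually_ne)
  have inner_eq: "\<forall>\<^sub>F s in at 0. inner (log_map Z s) v = q * ln (norm s) + ln (norm (u s))"
    using disc u_ne
  proof eventually_elim
    case (elim s)
    then have "inner (log_map Z s) v = ln (norm s powi q * norm (u s))"
      unfolding v_def using Z_nonzero monomial
      by (subst inner_log_map) (simp_all add: norm_mult norm_power_int)
    also have "\<dots> = ln (norm s powi q) + ln (norm (u s))"
      using elim by (simp add: ln_mult)
    also have "ln (norm s powi q) = q * ln (norm s)"
      using elim by (simp add: ln_powr flip: powr_real_of_int')
    finally show ?case .
  qed
  \<comment> \<open>Cauchy-Schwarz transfers the logarithmic divergence of the pairing to the norm.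
    Dividing by \<open>norm v + 1\<close> keeps the divisor positive without a case split on
    \<open>v\<close>.\<close>
  have "filterlim (\<lambda>s. norm (log_map Z s)) at_top (at 0)"
  proof (rule filterlim_at_top_mono)
    show "filterlim (\<lambda>s::complex. inverse (norm v + 1) * (- K + (- ln (norm s)))) at_top (at 0)"
      by (intro filterlim_tendsto_pos_mult_at_top[OF tendsto_const]
          filterlim_tendsto_add_at_top[OF tendsto_const] log) (simp add: add_nonneg_pos)
    show "\<forall>\<^sub>F s in at 0. inverse (norm v + 1) * (- K + (- ln (norm s))) \<le> norm (log_map Z s)"
      using disc u_bound inner_eq
    proof eventually_elim
      case (elim s)
      \<comment> \<open>A nonzero integer has absolute value at least 1.\<close>
      have "1 * \<bar>ln (norm s)\<bar> \<le> \<bar>real_of_int q\<bar> * \<bar>ln (norm s)\<bar>"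
        using q_nonzero by (intro mult_right_mono) auto
      then have "- K + (- ln (norm s)) \<le> \<bar>inner (log_map Z s) v\<bar>"
        using elim(2,3) abs_mult[of "real_of_int q" "ln (norm s)"] by linarith
      also have "\<dots> \<le> norm (log_map Z s) * norm v"
        by (rule Cauchy_Schwarz_ineq2)
      also have "\<dots> \<le> norm (log_map Z s) * (norm v + 1)"
        by (intro mult_left_mono) auto
      finally show ?case
        using add_nonneg_pos[OF norm_ge_zero[of v] zero_less_one] by (simp add: field_simps)
    qed
  qed
  then obtain c where c: "c > 0"
      "\<forall>\<^sub>F s in at 0. c * norm (log_map Z s) \<le> \<bar>inner (log_map Z s) v\<bar>"
    using log_map_norm_bound[OF _ not_orthogonal, folded v_def] by blast
  \<comment> \<open>Near 0 also \<open>K \<le> - ln (norm s)\<close>, so \<open>K\<close> is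
    absorbed by raising the factor \<open>\<bar>q\<bar>\<close> by 1; dividing by \<open>c\<close>
    gives the growth exponent that \<open>N\<close> must dominate.\<close>
  obtain N :: nat where N: "(\<bar>real_of_int q\<bar> + 1) / c \<le> real N"
    using real_arch_simple by blast
  have growth: "\<forall>\<^sub>F s in at 0. norm ((s - 0) ^ N * Z s $ i) \<le> 1" for i
    using disc u_bound inner_eq c(2) filterlim_at_top[THEN iffD1, OF log, rule_format, of K]
  proof eventually_elim
    case (elim s)
    have "K \<ge> 0" by (simp add: K_def)
    have "c * norm (log_map Z s) \<le> \<bar>real_of_int q\<bar> * \<bar>ln (norm s)\<bar> + K"
      using elim(2-4) abs_mult[of "real_of_int q" "ln (norm s)"] by linarith
    also have "\<dots> \<le> (\<bar>real_of_int q\<bar> + 1) * (- ln (norm s))"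
      using elim(5) \<open>K \<ge> 0\<close> by (simp add: algebra_simps)
    finally have "norm (log_map Z s) \<le> (\<bar>real_of_int q\<bar> + 1) / c * (- ln (norm s))"
      using c(1) by (simp add: field_simps)
    also have "\<dots> \<le> real N * (- ln (norm s))"
      using N elim(5) \<open>K \<ge> 0\<close> by (intro mult_right_mono) auto
    finally have "norm (log_map Z s) \<le> real N * (- ln (norm s))" .
    moreover have "ln (norm (Z s $ i)) \<le> norm (log_map Z s)"
      using component_le_norm_cart[of "log_map Z s" i] by (simp add: log_map_def)
    \<comment> \<open>The term \<open>N * ln (norm s)\<close> contributed by \<open>s ^ N\<close>
      cancels the upper bound just found for \<open>ln (norm (Z s $ i))\<close>.\<close>
    ultimately have "ln (norm (s ^ N * Z s $ i)) \<le> 0"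
      using elim(1) Z_nonzero[of s i] by (simp add: norm_mult norm_power ln_mult ln_realpow)
    moreover have "norm (s ^ N * Z s $ i) > 0"
      using elim(1) Z_nonzero[of s i] by simp
    ultimately show ?case
      by (simp only: ln_le_zero_iff diff_zero)
  qed
  show ?thesis
    unfolding meromorphic_at_def
    using isolated_singularity_at_holomorphic[OF Z_holomorphic]
      not_essential_of_bounded_power_mult[OF Z_holomorphic _ _ growth]
    by auto
qed

end
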